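(* Let $\mathbb{K}$ be a field, $n\ge 1$ an integer, $<$ an admissible monomial order on the monoid $[\mathbf{x}]$ of monomials in $x_1,\dots,x_n$, and $R=\{s_1,\dots,s_r\}\subseteq \mathbb{K}[[\mathbf{x}]]\setminus\{0\}$ a set of exactly $r\geq 0$ non-zero formal power series. Assume that $<$ is compatible with the degree. Then the following three relations on $\mathbb{K}[[\mathbf{x}]]$ are equal: the congruence relation $\equiv_{I(R)}$ (where $f\equiv_{I(R)}g$ iff $f-g\in I(R)$), the equivalence relation generated by the topological rewriting relation $\xrightarrow{\mathrm{top}}$, and the equivalence relation generated by the topological rewriting with chains relation $\xrightarrow{\mathrm{ch}}$.
   Context: Formal power series. $[\mathbf{x}]$ is the free commutative monoid on the distinct indeterminates $x_1,\dots,x_n$; its elements are called monomials, $1$ is the empty monomial, and $\deg(x_1^{\mu_1}\cdots x_n^{\mu_n})=\mu_1+\cdots+\mu_n$. $\mathbb{K}[[\mathbf{x}]]=\mathbb{K}[[x_1,\dots,x_n]]$ is the algebra of formal power series; $\langle f\mid m\rangle$ is the coefficient of the monomial $m$ in $f$ and $\mathrm{supp}(f)=\{m:\langle f\mid m\rangle\neq 0\}$. The metric $\delta$ is $\delta(f,g)=2^{-\mathrm{val}(f-g)}$, where $\mathrm{val}(h)$ is the smallest degree of a monomial in $\mathrm{supp}(h)$ if $h\ne0$, $\mathrm{val}(0)=\infty$ and $2^{-\infty}=0$; $\tau_\delta$ is the induced topology and all limits are taken in it. Monomial orders. A monomial order is a total order $\le$ on $[\mathbf{x}]$ such that $m_1\le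 m_2$ implies $m m_1\le m m_2$ for all monomials $m,m_1,m_2$. It is admissible if $1\le m$ for all $m$; it is compatible with the degree if $\deg(m_1)<\deg(m_2)$ implies $m_1<m_2$. For $f\neq0$, $\mathrm{lm}(f)=\min_<\mathrm{supp}(f)$ and $\mathrm{lc}(f)=\langle f\mid \mathrm{lm}(f)\rangle$. The rewriting relations. $I(R)$ is the ideal of $\mathbb{K}[[\mathbf{x}]]$ generated by $R$. Write $f\to g$ if there exist $M\in\mathrm{supp}(f)$, $i\in\{1,\dots,r\}$ and $m\in[\mathbf{x}]$ with $M=m\cdot\mathrm{lm}(s_i)$ and $g=f-\frac{\langle f\mid M\rangle}{\mathrm{lc}(s_i)}\,m s_i$. $\xrightarrow{=}$ and $\xrightarrow{\star}$ denote the reflexive closure and the transitive reflexive closure of $\to$. $f\xrightarrow{\mathrm{top}}g$ means that $(f,g)$ is in the closure of the relation $\xrightarrow{\star}$, viewed as a subset of $\mathbb{K}[[\mathbf{x}]]\times\mathbb{K}[[\mathbf{x}]]$ with the product of the discrete topology (first factor) and $\tau_\delta$ (second factor). $f\xrightarrow{\mathrm{ch}}g$ means that there is a sequence $(h_k)_{k\in\mathbb{N}}$ in $\mathbb{K}[[\mathbf{x}]]$ with $h_0=f$, $h_k\xrightarrow{=}h_{k+1}$ for all $k$, and $\lim_{k\to\infty}h_k=g$. *)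

theory Defs
  imports "HOL-Analysis.Analysis" "HOL-Library.Multiset"
begin

text \<open>
  The free commutative monoid on the indeterminates \<open>'v\<close> is \<^typ>\<open>'v multiset\<close>, written
  additively: the product of monomials is \<open>+\<close>, the empty monomial is \<open>{#}\<close>, and the
  degree is \<^const>\<open>size\<close>.  The number of indeterminates is \<open>CARD('v)\<close>.
\<close>

typedef ('v, 'a) mfps = "UNIV :: ('v multiset \<Rightarrow> 'a) set"
  morphisms mfps_coeff Abs_mfps
  by simp

lemma mfps_coeff_Abs_mfps [simp]: "mfps_coeff (Abs_mfps F) = F"
  by (simp add: Abs_mfps_inverse)

lemma mfps_eq_iff: "f = g \<longleftrightarrow> (\<forall>m. mfps_coeff f m = mfps_coeff g m)"
  by (auto simp: mfps_coeff_inject[symmetric])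

lemma mfps_eqI: "(\<And>m. mfps_coeff f m = mfps_coeff g m) \<Longrightarrow> f = g"
  by (simp add: mfps_eq_iff)

lemma finite_submultisets: "finite {a. a \<subseteq># (m :: 'v multiset)}"
proof (rule finite_subset)
  show "{a. a \<subseteq># m} \<subseteq> (\<Union>k\<le>size m. multisets_of_size (set_mset m) k)"
    by (auto simp: multisets_of_size_def size_mset_mono dest: mset_subset_eqD)
  show "finite (\<Union>k\<le>size m. multisets_of_size (set_mset m) k)"
    by (auto intro!: finite_multisets_of_size)
qed


subsection \<open>The ring of formal power series\<close>

instantiation mfps :: (type, zero) zero
begin
definition zero_mfps_def: "0 = Abs_mfps (\<lambda>_. 0)"
instance ..
end

instantiation mfps :: (type, "{one, zero}") one
begin
definition one_mfps_def: "1 = Abs_mfps (\<lambda>m. if m = {#} then 1 else 0)"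
instance ..
end

instantiation mfps :: (type, plus) plus
begin
definition plus_mfps_def: "f + g = Abs_mfps (\<lambda>m. mfps_coeff f m + mfps_coeff g m)"
instance ..
end

instantiation mfps :: (type, minus) minus
begin
definition minus_mfps_def: "f - g = Abs_mfps (\<lambda>m. mfps_coeff f m - mfps_coeff g m)"
instance ..
end

instantiation mfps :: (type, uminus) uminus
begin
definition uminus_mfps_def: "- f = Abs_mfps (\<lambda>m. - mfps_coeff f m)"
instance ..
end

instantiation mfps :: (type, "{comm_monoid_add, times}") times
begin
definition times_mfps_def:
  "f * g = Abs_mfps (\<lambda>m. \<Sum>a | a \<subseteq># m. mfps_coeff f a * mfps_coeff g (m - a))"
instance ..
end

lemma mfps_coeff_0 [simp]: "mfps_coeff 0 m = 0"
  by (simp add: zero_mfps_def)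

lemma mfps_coeff_1: "mfps_coeff 1 m = (if m = {#} then 1 else 0)"
  by (simp add: one_mfps_def)

lemma mfps_coeff_add [simp]: "mfps_coeff (f + g) m = mfps_coeff f m + mfps_coeff g m"
  by (simp add: plus_mfps_def)

lemma mfps_coeff_diff [simp]: "mfps_coeff (f - g) m = mfps_coeff f m - mfps_coeff g m"
  by (simp add: minus_mfps_def)

lemma mfps_coeff_uminus [simp]: "mfps_coeff (- f) m = - mfps_coeff f m"
  by (simp add: uminus_mfps_def)

lemma mfps_coeff_mult:
  "mfps_coeff (f * g) m = (\<Sum>a | a \<subseteq># m. mfps_coeff f a * mfps_coeff g (m - a))"
  by (simp add: times_mfps_def)

instance mfps :: (type, ab_group_add) ab_group_add
  by standard (rule mfps_eqI, simp add: add.assoc add.commute)+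

instance mfps :: (type, comm_ring_1) comm_ring_1
proof
  fix f g h :: "('a, 'b) mfps"
  show "f * g * h = f * (g * h)"
  proof (rule mfps_eqI)
    fix m :: "'a multiset"
    have "mfps_coeff (f * g * h) m =
        (\<Sum>a | a \<subseteq># m. \<Sum>b | b \<subseteq># a.
          mfps_coeff f b * mfps_coeff g (a - b) * mfps_coeff h (m - a))"
      by (simp add: mfps_coeff_mult sum_distrib_right)
    also have "\<dots> = (\<Sum>(a, b)\<in>(SIGMA a:{a. a \<subseteq># m}. {b. b \<subseteq># a}).
        mfps_coeff f b * mfps_coeff g (a - b) * mfps_coeff h (m - a))"
      by (rule sum.Sigma) (simp_all add: finite_submultisets)
    also have "\<dots> = (\<Sum>(a, b)\<in>(SIGMA a:{a. a \<subseteq># m}. {b. b \<subseteq># m - a}).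
        mfps_coeff f a * (mfps_coeff g b * mfps_coeff h (m - a - b)))"
    proof (rule sum.reindex_bij_witness[where
          i = "\<lambda>(a, b). (a + b, a)" and j = "\<lambda>(a, b). (b, a - b)"], goal_cases)
      case (1 x) then show ?case by (auto simp: subset_mset.add_diff_inverse)
    next
      case (2 x)
      then obtain a b where x: "x = (a, b)" and ab: "a \<subseteq># m" "b \<subseteq># a" by auto
      have "a - b \<subseteq># m - b"
        using ab by (simp add: subseteq_mset_def diff_le_mono)
      with x ab show ?case by (auto intro: subset_mset.order_trans)
    next
      case (3 x) then show ?case by (auto)
    next
      case (4 x)
      then obtain a b where x: "x = (a, b)" and ab: "a \<subseteq># m" "b \<subseteq># m - a" by auto
      then have "a + b \<subseteq># m"
        by (metis subset_mset.add_left_mono subset_mset.add_diff_inverse)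
      with x show ?case by simp
    next
      case (5 x)
      then show ?case by (auto simp: subset_mset.add_diff_inverse diff_diff_add_mset mult.assoc)
    qed
    also have "\<dots> = (\<Sum>a | a \<subseteq># m. \<Sum>b | b \<subseteq># m - a.
        mfps_coeff f a * (mfps_coeff g b * mfps_coeff h (m - a - b)))"
      by (rule sum.Sigma[symmetric]) (simp_all add: finite_submultisets)
    also have "\<dots> = mfps_coeff (f * (g * h)) m"
      by (simp add: mfps_coeff_mult sum_distrib_left)
    finally show "mfps_coeff (f * g * h) m = mfps_coeff (f * (g * h)) m" .
  qed
  show "f * g = g * f"
  proof (rule mfps_eqI)
    fix m :: "'a multiset"
    show "mfps_coeff (f * g) m = mfps_coeff (g * f) m"
      unfolding mfps_coeff_mult
      by (rule sum.reindex_bij_witness[where i = "\<lambda>a. m - a" and j = "\<lambda>a. m - a"])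
        (auto simp: mult.commute subset_mset.diff_diff_right)
  qed
  show "1 * f = f"
  proof (rule mfps_eqI)
    fix m :: "'a multiset"
    have "mfps_coeff (1 * f) m = (\<Sum>a | a \<subseteq># m. if a = {#} then mfps_coeff f m else 0)"
      unfolding mfps_coeff_mult by (rule sum.cong) (auto simp: mfps_coeff_1)
    also have "\<dots> = mfps_coeff f m"
      by (simp add: sum.delta finite_submultisets)
    finally show "mfps_coeff (1 * f) m = mfps_coeff f m" .
  qed
  show "(f + g) * h = f * h + g * h"
    by (rule mfps_eqI) (simp add: mfps_coeff_mult distrib_right sum.distrib)
  show "(0 :: ('a, 'b) mfps) \<noteq> 1"
    by (auto simp: mfps_eq_iff mfps_coeff_1)
qed

definition mfps_supp :: "('v, 'a::zero) mfps \<Rightarrow> 'v multiset set" where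
  "mfps_supp f = {m. mfps_coeff f m \<noteq> 0}"

definition mfps_term :: "'a::zero \<Rightarrow> 'v multiset \<Rightarrow> ('v, 'a) mfps" where
  "mfps_term c m = Abs_mfps (\<lambda>m'. if m' = m then c else 0)"


subsection \<open>The metric\<close>

text \<open>The value of \<open>mfps_val\<close> at \<open>0\<close> is unspecified; the distance treats that case separately.\<close>

definition mfps_val :: "('v, 'a::zero) mfps \<Rightarrow> nat" where
  "mfps_val f = (LEAST d. \<exists>m\<in>mfps_supp f. size m = d)"

lemma mfps_val_le: "m \<in> mfps_supp f \<Longrightarrow> mfps_val f \<le> size m"
  unfolding mfps_val_def by (intro Least_le bexI[of _ m] refl)

lemma mfps_val_attained:
  assumes "f \<noteq> 0"
  shows "\<exists>m\<in>mfps_supp f. size m = mfps_val f"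
proof -
  from assms obtain m where "m \<in> mfps_supp f"
    by (auto simp: mfps_eq_iff mfps_supp_def)
  then have "\<exists>d. \<exists>m\<in>mfps_supp f. size m = d"
    by blast
  then show ?thesis
    unfolding mfps_val_def by (rule LeastI_ex)
qed

instantiation mfps :: (type, "{minus, zero}") dist
begin
definition dist_mfps_def:
  "dist f g = (if f = g then 0 else inverse (2 ^ mfps_val (f - g)))"
instance ..
end

instantiation mfps :: (type, ab_group_add) metric_space
begin

definition uniformity_mfps_def [code del]:
  "(uniformity :: (('a, 'b) mfps \<times> ('a, 'b) mfps) filter) =
    (INF e\<in>{0 <..}. principal {(x, y). dist x y < e})"

definition open_mfps_def [code del]:
  "open (U :: ('a, 'b) mfps set) \<longleftrightarrow>
    (\<forall>x\<in>U. eventually (\<lambda>(x', y). x' = x \<longrightarrow> y \<in> U) uniformity)"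

instance
proof
  fix f g h :: "('a, 'b) mfps"
  show "dist f g = 0 \<longleftrightarrow> f = g"
    by (simp add: dist_mfps_def)
  have nonneg: "dist p q \<ge> 0" for p q :: "('a, 'b) mfps"
    by (simp add: dist_mfps_def)
  have dist_sym: "dist p q = dist q p" for p q :: "('a, 'b) mfps"
  proof -
    have "mfps_supp (p - q) = mfps_supp (q - p)"
      unfolding mfps_supp_def mfps_coeff_diff right_minus_eq by (simp only: eq_commute)
    then have "mfps_val (p - q) = mfps_val (q - p)"
      by (simp only: mfps_val_def)
    then show ?thesis
      unfolding dist_mfps_def by (cases "p = q") simp_all
  qed
  show "dist f g \<le> dist f h + dist g h"
  proof (cases "f = g \<or> f = h \<or> g = h")
    case True
    have self: "dist p p = 0" for p :: "('a, 'b) mfps"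
      by (simp add: dist_mfps_def)
    from True consider "f = g" | "f = h" | "g = h" by blast
    then show ?thesis
    proof cases
      case 1
      with nonneg[of f h] show ?thesis by (simp add: self)
    next
      case 2
      with dist_sym[of f g] show ?thesis by (simp only: self)
    next
      case 3
      then show ?thesis by (simp only: self)
    qed
  next
    case False
    then obtain m where m: "m \<in> mfps_supp (f - g)" "size m = mfps_val (f - g)"
      using mfps_val_attained[of "f - g"] by auto
    then have "m \<in> mfps_supp (f - h) \<or> m \<in> mfps_supp (g - h)"
      by (auto simp: mfps_supp_def)
    then have "mfps_val (f - h) \<le> mfps_val (f - g) \<or> mfps_val (g - h) \<le> mfps_val (f - g)"
      using m(2) mfps_val_le by metis
    moreover have "inverse (2 ^ j) \<le> (inverse (2 ^ i) :: real)" if "i \<le> j" for i j :: nat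
      using that by (simp add: field_simps power_increasing)
    ultimately have "dist f g \<le> dist f h \<or> dist f g \<le> dist g h"
      unfolding dist_mfps_def using False by auto
    with nonneg[of f h] nonneg[of g h] show ?thesis by linarith
  qed
qed (simp_all add: uniformity_mfps_def open_mfps_def)

end


subsection \<open>Monomial orders\<close>

text \<open>An order is given by its non-strict relation \<open>le\<close>; the strict one is derived from it.\<close>

definition monomial_order :: "('v multiset \<Rightarrow> 'v multiset \<Rightarrow> bool) \<Rightarrow> bool" where
  "monomial_order le \<longleftrightarrow>
    class.linorder le (\<lambda>m1 m2. le m1 m2 \<and> m1 \<noteq> m2) \<and>
    (\<forall>m m1 m2. le m1 m2 \<longrightarrow> le (m + m1) (m + m2))"

definition admissible :: "('v multiset \<Rightarrow> 'v multiset \<Rightarrow> bool) \<Rightarrow> bool" where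
  "admissible le \<longleftrightarrow> (\<forall>m. le {#} m)"

definition degree_compatible :: "('v multiset \<Rightarrow> 'v multiset \<Rightarrow> bool) \<Rightarrow> bool" where
  "degree_compatible le \<longleftrightarrow>
    (\<forall>m1 m2. size m1 < size m2 \<longrightarrow> le m1 m2 \<and> m1 \<noteq> m2)"

definition lm :: "('v multiset \<Rightarrow> 'v multiset \<Rightarrow> bool) \<Rightarrow> ('v, 'a::zero) mfps \<Rightarrow> 'v multiset" where
  "lm le f = (THE m. m \<in> mfps_supp f \<and> (\<forall>m'\<in>mfps_supp f. le m m'))"

definition lc :: "('v multiset \<Rightarrow> 'v multiset \<Rightarrow> bool) \<Rightarrow> ('v, 'a::zero) mfps \<Rightarrow> 'a" where
  "lc le f = mfps_coeff f (lm le f)"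


subsection \<open>Ideals and rewriting\<close>

text \<open>The ideals of a commutative ring are its submodules as a module over itself.\<close>

lemma module_self: "module ((*) :: 'a::comm_ring_1 \<Rightarrow> 'a \<Rightarrow> 'a)"
  by standard (simp_all add: algebra_simps)

definition ideal_generated :: "'a::comm_ring_1 set \<Rightarrow> 'a set" where
  "ideal_generated R = module.span (*) R"

definition ideal_cong :: "'a::comm_ring_1 set \<Rightarrow> 'a \<Rightarrow> 'a \<Rightarrow> bool" where
  "ideal_cong I f g \<longleftrightarrow> f - g \<in> I"

definition rewrite_step ::
  "('v multiset \<Rightarrow> 'v multiset \<Rightarrow> bool) \<Rightarrow> ('v, 'a::field) mfps set \<Rightarrow>
    ('v, 'a) mfps \<Rightarrow> ('v, 'a) mfps \<Rightarrow> bool" where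
  "rewrite_step le R f g \<longleftrightarrow>
    (\<exists>M\<in>mfps_supp f. \<exists>s\<in>R. \<exists>m. M = m + lm le s \<and>
      g = f - mfps_term (mfps_coeff f M / lc le s) m * s)"

definition top_rewrite ::
  "('v multiset \<Rightarrow> 'v multiset \<Rightarrow> bool) \<Rightarrow> ('v, 'a::field) mfps set \<Rightarrow>
    ('v, 'a) mfps \<Rightarrow> ('v, 'a) mfps \<Rightarrow> bool" where
  "top_rewrite le R f g \<longleftrightarrow>
    (f, g) \<in> prod_topology (discrete_topology UNIV) euclidean
      closure_of {(f', g'). (rewrite_step le R)\<^sup>*\<^sup>* f' g'}"

definition chain_rewrite ::
  "('v multiset \<Rightarrow> 'v multiset \<Rightarrow> bool) \<Rightarrow> ('v, 'a::field) mfps set \<Rightarrow>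
    ('v, 'a) mfps \<Rightarrow> ('v, 'a) mfps \<Rightarrow> bool" where
  "chain_rewrite le R f g \<longleftrightarrow>
    (\<exists>h. h 0 = f \<and> (\<forall>k. (rewrite_step le R)\<^sup>=\<^sup>= (h k) (h (Suc k))) \<and> h \<longlonglongrightarrow> g)"

end

theory Submission
  imports Defs
begin

text \<open>
  The three relations are compared in a circle: congruent series are connected by chains, a
  chain is a topological rewriting, and topological rewriting stays within a congruence class.

  The last inclusion holds because every ideal is closed (\<open>closed_ideal_generated\<close>): if \<open>f\<close> rewrites
  to series converging to \<open>g\<close>, their differences from \<open>f\<close> lie in the ideal and converge to
  \<open>f - g\<close>.  Closedness rests on two facts.  By Dickson's lemma an ideal contains a finite standard
  basis: finitely many elements such that every leading monomial of the ideal is divisible by one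
  of theirs.  And dividing by finitely many series works in \<open>\<omega>\<close> steps (\<open>division\<close>), since an
  order compatible with the degree lists the monomials as a sequence.  An element of the closure
  then has remainder \<open>0\<close> modulo the standard basis, as a non-zero remainder would have the same
  leading monomial as some element of the ideal.

  The first inclusion is proved one generator at a time.  If \<open>f - g = c * s\<close>, then dividing \<open>f\<close> and
  \<open>g\<close> by the single series \<open>s\<close> gives remainders whose difference is a multiple of \<open>s\<close>; a
  non-zero multiple has a monomial divisible by the leading monomial of \<open>s\<close>, so the remainders are
  equal, and division reaches them by chains.  Rewriting by all of \<open>R\<close> need not be confluent,
  which is why the generators are treated separately.
\<close>

section \<open>Dickson's lemma\<close>

lemma nat_seq_mono_subseq:
  fixes g :: "nat \<Rightarrow> nat"
  obtains r :: "nat \<Rightarrow> nat" where "strict_mono r" "mono (g \<circ> r)"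
proof -
  obtain r where r: "strict_mono r" "monoseq (\<lambda>n. g (r n))"
    using seq_monosub[of g] by auto
  show thesis
  proof (cases "\<forall>m. \<forall>n\<ge>m. g (r m) \<le> g (r n)")
    case True
    with r(1) show thesis by (intro that[of r]) (auto simp: mono_def)
  next
    case False
    with r(2) have dec: "g (r n) \<le> g (r m)" if "m \<le> n" for m n
      using that unfolding monoseq_def by blast
    \<comment> \<open>A decreasing sequence of naturals is constant from the place of its minimum on.\<close>
    obtain N where N: "\<And>n. g (r N) \<le> g (r n)"
      using ex_has_least_nat[of "\<lambda>_. True" _ "\<lambda>n. g (r n)"] by auto
    have "g (r (N + i)) = g (r N)" for i
      using dec[of N "N + i"] N[of "N + i"] by simp
    then have "mono (g \<circ> (\<lambda>i. r (N + i)))"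
      by (simp add: mono_def)
    moreover have "strict_mono (\<lambda>i. r (N + i))"
      using r(1) by (simp add: strict_mono_def)
    ultimately show thesis by (intro that)
  qed
qed

lemma multiset_seq_mono_subseq:
  fixes f :: "nat \<Rightarrow> 'v multiset"
  assumes "finite V"
  obtains r :: "nat \<Rightarrow> nat" where "strict_mono r" "\<And>v. v \<in> V \<Longrightarrow> mono (\<lambda>i. count (f (r i)) v)"
proof -
  from assms have "\<exists>r :: nat \<Rightarrow> nat. strict_mono r \<and> (\<forall>v\<in>V. mono (\<lambda>i. count (f (r i)) v))"
  proof induction
    case empty
    show ?case using strict_mono_id by auto
  next
    case (insert w V)
    then obtain r :: "nat \<Rightarrow> nat" where r: "strict_mono r" "\<forall>v\<in>V. mono (\<lambda>i. count (f (r i)) v)"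
      by blast
    obtain q :: "nat \<Rightarrow> nat" where q: "strict_mono q" "mono ((\<lambda>i. count (f (r i)) w) \<circ> q)"
      using nat_seq_mono_subseq .
    have "mono (\<lambda>i. count (f (r (q i))) v)" if "v \<in> V" for v
      using r(2) that strict_mono_mono[OF q(1)] by (auto simp: mono_def)
    then show ?case
      using q strict_mono_o[OF r(1) q(1)] by (intro exI[of _ "r \<circ> q"]) (auto simp: o_def)
  qed
  then show thesis using that by blast
qed

text \<open>
  The minimal elements of \<open>A\<close> under divisibility do the job: infinitely many of them
  would, after passing to a subsequence along which all exponents increase, contain
  two distinct comparable ones.
\<close>

lemma dickson:
  fixes A :: "'v::finite multiset set"
  obtains B where "B \<subseteq> A" "finite B" "\<forall>a\<in>A. \<exists>b\<in>B. b \<subseteq># a"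
proof -
  define B where "B = {b\<in>A. \<forall>a\<in>A. a \<subseteq># b \<longrightarrow> a = b}"
  have "finite B"
  proof (rule ccontr)
    assume "infinite B"
    then obtain f :: "nat \<Rightarrow> 'v multiset" where f: "inj f" "range f \<subseteq> B"
      using infinite_countable_subset by blast
    obtain r :: "nat \<Rightarrow> nat" where r: "strict_mono r" "\<And>v. mono (\<lambda>i. count (f (r i)) v)"
      using multiset_seq_mono_subseq[of UNIV f] by auto
    have "f (r 0) \<subseteq># f (r 1)"
      using r(2) by (simp add: subseteq_mset_def mono_def)
    then have "f (r 0) = f (r 1)"
      using f(2) unfolding B_def by blast
    then have "r 0 = r 1"
      using f(1) by (simp add: inj_eq)
    then show False
      using r(1) by (simp add: strict_mono_eq)
  qed
  moreover have "\<exists>b\<in>B. b \<subseteq># a" if "a \<in> A" for a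
    using that
  proof (induction "size a" arbitrary: a rule: less_induct)
    case less
    show ?case
    proof (cases "a \<in> B")
      case False
      then obtain a' where a': "a' \<in> A" "a' \<subset># a"
        using less.prems unfolding B_def by (auto simp: subset_mset.less_le)
      then show ?thesis
        using less.hyps[of a'] mset_subset_size subset_mset.order_trans
        by (metis subset_mset.less_imp_le)
    qed auto
  qed
  ultimately show thesis
    by (intro that[of B]) (auto simp: B_def)
qed


section \<open>Coefficients, ideals and the metric\<close>

lemma finite_bounded_degree: "finite {m :: 'v::finite multiset. size m \<le> d}"
proof (rule finite_subset)
  show "{m :: 'v multiset. size m \<le> d} \<subseteq> (\<Union>k\<le>d. multisets_of_size UNIV k)"
    by (auto simp: multisets_of_size_def)
qed (auto intro!: finite_multisets_of_size)

lemma mfps_coeff_term_mult: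
  fixes s :: "('v, 'a::comm_ring_1) mfps"
  shows "mfps_coeff (mfps_term c m * s) M = (if m \<subseteq># M then c * mfps_coeff s (M - m) else 0)"
proof -
  have "mfps_coeff (mfps_term c m * s) M =
      (\<Sum>a | a \<subseteq># M. if a = m then c * mfps_coeff s (M - m) else 0)"
    unfolding mfps_coeff_mult by (rule sum.cong) (auto simp: mfps_term_def)
  then show ?thesis
    by (simp add: sum.delta finite_submultisets)
qed

lemma mfps_coeff_sum: "mfps_coeff (\<Sum>i\<in>A. f i) m = (\<Sum>i\<in>A. mfps_coeff (f i) m)"
  for f :: "'i \<Rightarrow> ('v, 'a::ab_group_add) mfps"
  by (induction A rule: infinite_finite_induct) auto

lemma ideal_generated_add:
  "x \<in> ideal_generated R \<Longrightarrow> y \<in> ideal_generated R \<Longrightarrow> x + y \<in> ideal_generated R"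
  unfolding ideal_generated_def by (rule module.span_add[OF module_self])

lemma ideal_generated_diff:
  "x \<in> ideal_generated R \<Longrightarrow> y \<in> ideal_generated R \<Longrightarrow> x - y \<in> ideal_generated R"
  unfolding ideal_generated_def by (rule module.span_diff[OF module_self])

lemma ideal_generated_0: "0 \<in> ideal_generated R"
  unfolding ideal_generated_def by (rule module.span_zero[OF module_self])

lemma ideal_generated_mult: "x \<in> R \<Longrightarrow> c * x \<in> ideal_generated R"
  unfolding ideal_generated_def
  by (intro module.span_scale[OF module_self] module.span_base[OF module_self])

lemma ideal_generated_subset:
  assumes "G \<subseteq> ideal_generated R"
  shows "ideal_generated G \<subseteq> ideal_generated R"
  using assms unfolding ideal_generated_def
  by (intro module.span_minimal[OF module_self] module.subspace_span[OF module_self])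

lemma ideal_cong_equivp: "equivp (ideal_cong (ideal_generated R))"
proof (rule equivpI)
  show "reflp (ideal_cong (ideal_generated R))"
    by (simp add: reflp_def ideal_cong_def ideal_generated_0)
  show "symp (ideal_cong (ideal_generated R))"
    using ideal_generated_diff[OF ideal_generated_0]
    by (fastforce simp: symp_def ideal_cong_def)
  show "transp (ideal_cong (ideal_generated R))"
    using ideal_generated_add by (fastforce simp: transp_def ideal_cong_def)
qed

lemma dist_mfps_less_iff:
  fixes f g :: "('v, 'a::ab_group_add) mfps"
  shows "dist f g < inverse (2 ^ d) \<longleftrightarrow>
    (\<forall>m. size m \<le> d \<longrightarrow> mfps_coeff f m = mfps_coeff g m)"
proof (cases "f = g")
  case False
  then have ex: "\<exists>m. m \<in> mfps_supp (f - g) \<and> size m = mfps_val (f - g)"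
    using mfps_val_attained[of "f - g"] by auto
  have "dist f g < inverse (2 ^ d) \<longleftrightarrow> d < mfps_val (f - g)"
    using False by (simp add: dist_mfps_def)
  also have "\<dots> \<longleftrightarrow> (\<forall>m. size m \<le> d \<longrightarrow> m \<notin> mfps_supp (f - g))"
    using ex mfps_val_le[of _ "f - g"] by (metis le_trans not_le)
  finally show ?thesis
    by (simp add: mfps_supp_def)
qed (simp add: dist_mfps_def)

lemma ex_inverse_power2_less:
  fixes e :: real
  assumes "e > 0"
  obtains d :: nat where "inverse (2 ^ d) < e"
  using real_arch_pow_inv[OF assms, of "1/2"] by (auto simp: field_simps)

lemma closure_mfps_iff:
  fixes S :: "('v, 'a::ab_group_add) mfps set"
  shows "f \<in> closure S \<longleftrightarrow>
    (\<forall>d. \<exists>g\<in>S. \<forall>m. size m \<le> d \<longrightarrow> mfps_coeff g m = mfps_coeff f m)" (is "_ \<longleftrightarrow> ?R")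
proof
  assume "f \<in> closure S"
  then show ?R
    unfolding closure_approachable dist_mfps_less_iff[symmetric] by simp
next
  assume R: ?R
  show "f \<in> closure S"
    unfolding closure_approachable
  proof (intro allI impI)
    fix e :: real assume "e > 0"
    then obtain d :: nat where "inverse (2 ^ d) < e"
      by (rule ex_inverse_power2_less)
    then show "\<exists>g\<in>S. dist g f < e"
      using R[unfolded dist_mfps_less_iff[symmetric], rule_format, of d] order.strict_trans by blast
  qed
qed

text \<open>
  There are only finitely many monomials of each degree, so coefficientwise stabilisation
  is automatically uniform in each degree.
\<close>

lemma mfps_tendstoI:
  fixes h :: "nat \<Rightarrow> ('v::finite, 'a::ab_group_add) mfps"
  assumes "\<And>m. eventually (\<lambda>k. mfps_coeff (h k) m = mfps_coeff g m) sequentially"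
  shows "h \<longlonglongrightarrow> g"
proof (rule tendstoI)
  fix e :: real assume "e > 0"
  then obtain d :: nat where d: "inverse (2 ^ d) < e"
    by (rule ex_inverse_power2_less)
  have "eventually (\<lambda>k. \<forall>m\<in>{m. size m \<le> d}. mfps_coeff (h k) m = mfps_coeff g m) sequentially"
    using assms by (intro eventually_ball_finite[OF finite_bounded_degree]) blast
  then show "eventually (\<lambda>k. dist (h k) g < e) sequentially"
  proof eventually_elim
    case (elim k)
    then have "dist (h k) g < inverse (2 ^ d)"
      by (simp add: dist_mfps_less_iff)
    with d show ?case by simp
  qed
qed

lemma continuous_on_mfps_diff:
  fixes f :: "('v, 'a::ab_group_add) mfps"
  shows "continuous_on UNIV (\<lambda>g. f - g)"
proof -
  have "dist (f - g) (f - g') = dist g' g" for g g'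
    by (simp add: dist_mfps_def eq_commute)
  then show ?thesis
    unfolding continuous_on_iff by (metis dist_commute)
qed


section \<open>The two infinite rewriting relations\<close>

text \<open>
  Since the first factor is discrete, the closure is taken separately over each \<open>f\<close>.
\<close>

lemma top_rewrite_iff:
  "top_rewrite le R f g \<longleftrightarrow> g \<in> closure {g'. (rewrite_step le R)\<^sup>*\<^sup>* f g'}"
proof
  assume top: "top_rewrite le R f g"
  show "g \<in> closure {g'. (rewrite_step le R)\<^sup>*\<^sup>* f g'}"
    unfolding closure_iff_nhds_not_empty
  proof (intro allI impI)
    fix A V assume V: "V \<subseteq> A" "open V" "g \<in> V"
    have "openin (prod_topology (discrete_topology UNIV) euclidean) ({f} \<times> V)"
      using V(2) by (simp add: openin_prod_Times_iff)
    with top V(3) have "\<exists>y. y \<in> {(f', g'). (rewrite_step le R)\<^sup>*\<^sup>* f' g'} \<and> y \<in> {f} \<times> V"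
      unfolding top_rewrite_def in_closure_of by (elim conjE allE[of _ "{f} \<times> V"]) simp
    then obtain g' where "(rewrite_step le R)\<^sup>*\<^sup>* f g'" "g' \<in> V"
      by (elim exE conjE SigmaE) simp
    with V(1) have "g' \<in> {g'. (rewrite_step le R)\<^sup>*\<^sup>* f g'} \<inter> A"
      by (simp add: subset_iff)
    then show "{g'. (rewrite_step le R)\<^sup>*\<^sup>* f g'} \<inter> A \<noteq> {}"
      by (rule ex_in_conv[THEN iffD1, OF exI])
  qed
next
  assume cl: "g \<in> closure {g'. (rewrite_step le R)\<^sup>*\<^sup>* f g'}"
  show "top_rewrite le R f g"
    unfolding top_rewrite_def in_closure_of
  proof (intro conjI allI impI)
    fix T assume "(f, g) \<in> T \<and>
      openin (prod_topology (discrete_topology UNIV) euclidean) T"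
    then have "\<exists>U V. openin (discrete_topology UNIV) U \<and> openin euclidean V \<and>
        f \<in> U \<and> g \<in> V \<and> U \<times> V \<subseteq> T"
      unfolding openin_prod_topology_alt by simp
    then obtain U V where V: "open V" "g \<in> V" "f \<in> U" "U \<times> V \<subseteq> T"
      by (elim exE conjE) simp
    have "{g'. (rewrite_step le R)\<^sup>*\<^sup>* f g'} \<inter> V \<noteq> {}"
      by (rule cl[unfolded closure_iff_nhds_not_empty, rule_format, OF subset_refl V(1,2)])
    then obtain g' where "(rewrite_step le R)\<^sup>*\<^sup>* f g'" "g' \<in> V"
      unfolding ex_in_conv[symmetric] by (elim exE IntE) simp
    with V(3,4) show "\<exists>y. y \<in> {(f', g'). (rewrite_step le R)\<^sup>*\<^sup>* f' g'} \<and> y \<in> T"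
      by (intro exI[of _ "(f, g')"]) (simp add: subset_iff)
  qed simp
qed

lemma chain_rewrite_imp_top_rewrite:
  assumes "chain_rewrite le R f g"
  shows "top_rewrite le R f g"
proof -
  obtain h where h: "h 0 = f" "\<And>k. (rewrite_step le R)\<^sup>=\<^sup>= (h k) (h (Suc k))" "h \<longlonglongrightarrow> g"
    using assms unfolding chain_rewrite_def by blast
  have "(rewrite_step le R)\<^sup>*\<^sup>* f (h k)" for k
  proof (induction k)
    case (Suc k)
    then show ?case
      using h(2)[of k] by (auto intro: rtranclp.rtrancl_into_rtrancl)
  qed (simp add: h(1))
  with h(3) show ?thesis
    unfolding top_rewrite_iff closure_sequential by (intro exI[of _ h]) simp
qed

lemma chain_rewrite_mono:
  assumes "G \<subseteq> R" "chain_rewrite le G f g"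
  shows "chain_rewrite le R f g"
proof -
  have "rewrite_step le R p q" if "rewrite_step le G p q" for p q
  proof -
    from that obtain M s m where "M \<in> mfps_supp p" "s \<in> G" "M = m + lm le s"
      "q = p - mfps_term (mfps_coeff p M / lc le s) m * s"
      unfolding rewrite_step_def by (elim bexE exE conjE)
    moreover from this(2) assms(1) have "s \<in> R" by (rule rev_subsetD)
    ultimately show ?thesis
      unfolding rewrite_step_def by (intro bexI[of _ M] bexI[of _ s] exI[of _ m] conjI)
  qed
  then have "(rewrite_step le R)\<^sup>=\<^sup>= p q" if "(rewrite_step le G)\<^sup>=\<^sup>= p q" for p q
    using that by (elim sup2E) simp_all
  moreover obtain h where "h 0 = f" "\<And>k. (rewrite_step le G)\<^sup>=\<^sup>= (h k) (h (Suc k))" "h \<longlonglongrightarrow> g"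
    using assms(2) unfolding chain_rewrite_def by (elim exE conjE) simp
  ultimately show ?thesis
    unfolding chain_rewrite_def by (intro exI[of _ h]) simp
qed

lemma rewrite_steps_ideal_cong:
  assumes "(rewrite_step le R)\<^sup>*\<^sup>* f g"
  shows "ideal_cong (ideal_generated R) f g"
  using assms
proof induction
  case base
  show ?case by (simp add: equivp_reflp[OF ideal_cong_equivp])
next
  case (step g h)
  then have "ideal_cong (ideal_generated R) g h"
    unfolding rewrite_step_def ideal_cong_def by (auto intro: ideal_generated_mult)
  with step.IH show ?case
    using equivp_transp[OF ideal_cong_equivp] by blast
qed


section \<open>Leading monomials for orders compatible with the degree\<close>

locale graded_monomial_order =
  fixes le :: "'v::finite multiset \<Rightarrow> 'v multiset \<Rightarrow> bool"
  assumes monomial_order: "monomial_order le"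
    and degree_compatible: "degree_compatible le"
begin

sublocale linorder le "\<lambda>a b. le a b \<and> a \<noteq> b"
  using monomial_order by (simp add: monomial_order_def)

lemma add_left_mono: "le a b \<Longrightarrow> le (m + a) (m + b)"
  using monomial_order by (simp add: monomial_order_def)

lemma add_mono:
  assumes "le a b" "le c d"
  shows "le (a + c) (b + d)"
  using add_left_mono[OF assms(1), of c] add_left_mono[OF assms(2), of b]
  by (metis add.commute order_trans)

lemma size_mono: "le a b \<Longrightarrow> size a \<le> size b"
  using degree_compatible order_antisym unfolding degree_compatible_def
  by (metis linorder_class.not_le)

lemma finite_below: "finite {a. le a b}"
  by (rule finite_subset[OF _ finite_bounded_degree[of "size b"]]) (auto dest: size_mono)

text \<open>
  Below each monomial there are only finitely many others, so the monomials are ordered like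
  the natural numbers; \<open>rank\<close> is the isomorphism.
\<close>

definition rank :: "'v multiset \<Rightarrow> nat" where
  "rank b = card {a. le a b \<and> a \<noteq> b}"

lemma rank_less:
  assumes "le a b" "a \<noteq> b"
  shows "rank a < rank b"
  unfolding rank_def
proof (rule psubset_card_mono)
  show "finite {a. le a b \<and> a \<noteq> b}"
    using finite_below[of b] by (rule rev_finite_subset) auto
  show "{c. le c a \<and> c \<noteq> a} \<subset> {c. le c b \<and> c \<noteq> b}"
    using assms order_trans order_antisym by blast
qed

lemma rank_le_iff: "rank a \<le> rank b \<longleftrightarrow> le a b"
  using rank_less[of a b] rank_less[of b a] linear[of a b]
  by (metis le_refl less_imp_le_nat linorder_class.not_le order_antisym)

lemma rank_eq_iff: "rank a = rank b \<longleftrightarrow> a = b"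
  using rank_le_iff order_antisym by (metis order_refl le_refl)

lemma surj_rank: "surj rank"
proof -
  have initial: "{..<rank b} \<subseteq> range rank" for b
  proof -
    have "rank ` {a. le a b \<and> a \<noteq> b} = {..<rank b}"
    proof (rule card_subset_eq)
      show "card (rank ` {a. le a b \<and> a \<noteq> b}) = card {..<rank b}"
        by (simp add: card_image inj_on_def rank_eq_iff) (simp add: rank_def)
    qed (auto intro: rank_less)
    then show ?thesis by blast
  qed
  have "inj (\<lambda>k. replicate_mset k (undefined :: 'v))"
    by (rule injI) (metis size_replicate_mset)
  then have "infinite (UNIV :: 'v multiset set)"
    using finite_subset[OF subset_UNIV] range_inj_infinite by blast
  then have "infinite (range rank)"
    using finite_imageD[of rank UNIV] by (auto simp: inj_on_def rank_eq_iff)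
  then have "\<exists>b. k < rank b" for k
    using infinite_nat_iff_unbounded[of "range rank"] by auto
  with initial show ?thesis by blast
qed

definition nth_monomial :: "nat \<Rightarrow> 'v multiset" where
  "nth_monomial = inv rank"

lemma rank_nth_monomial [simp]: "rank (nth_monomial k) = k"
  unfolding nth_monomial_def by (rule surj_f_inv_f[OF surj_rank])

lemma nth_monomial_rank [simp]: "nth_monomial (rank m) = m"
  by (simp flip: rank_eq_iff)

lemma lm_least_in_supp:
  assumes "f \<noteq> 0"
  shows "lm le f \<in> mfps_supp f \<and> (\<forall>m\<in>mfps_supp f. le (lm le f) m)"
  unfolding lm_def
proof (rule theI')
  obtain m where "m \<in> mfps_supp f"
    using assms by (auto simp: mfps_supp_def mfps_eq_iff)
  then obtain a where "a \<in> mfps_supp f" "\<forall>m\<in>mfps_supp f. rank a \<le> rank m"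
    using ex_has_least_nat[of "\<lambda>a. a \<in> mfps_supp f" m rank] by blast
  then show "\<exists>!a. a \<in> mfps_supp f \<and> (\<forall>m\<in>mfps_supp f. le a m)"
    unfolding rank_le_iff using order_antisym by blast
qed

lemma lc_nonzero: "f \<noteq> 0 \<Longrightarrow> lc le f \<noteq> 0"
  using lm_least_in_supp[of f] by (auto simp: lc_def mfps_supp_def)

lemma lm_le: "mfps_coeff f m \<noteq> 0 \<Longrightarrow> le (lm le f) m"
  using lm_least_in_supp[of f] by (cases "f = 0") (auto simp: mfps_supp_def)

lemma lm_eqI:
  assumes "mfps_coeff f a \<noteq> 0" "\<And>m. mfps_coeff f m \<noteq> 0 \<Longrightarrow> le a m"
  shows "lm le f = a"
proof (rule order_antisym)
  show "le (lm le f) a"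
    using assms(1) by (rule lm_le)
  have "f \<noteq> 0"
    using assms(1) by auto
  then show "le a (lm le f)"
    using lm_least_in_supp[of f] assms(2) by (auto simp: mfps_supp_def)
qed

text \<open>
  In the convolution sum at \<open>lm q + lm s\<close> every other splitting has a factor below one of the
  two leading monomials.
\<close>

lemma mfps_coeff_mult_lm:
  fixes q s :: "('v, 'a::comm_ring_1) mfps"
  shows "mfps_coeff (q * s) (lm le q + lm le s) = lc le q * lc le s"
proof -
  let ?a = "lm le q" and ?b = "lm le s"
  have "mfps_coeff (q * s) (?a + ?b) =
      (\<Sum>a | a \<subseteq># ?a + ?b. if a = ?a then lc le q * lc le s else 0)"
    unfolding mfps_coeff_mult
  proof (rule sum.cong[OF refl])
    fix a assume "a \<in> {a. a \<subseteq># ?a + ?b}"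
    then have sum: "a + (?a + ?b - a) = ?a + ?b" by simp
    have "a = ?a" if nz: "mfps_coeff q a \<noteq> 0" "mfps_coeff s (?a + ?b - a) \<noteq> 0"
    proof -
      have "le (a + ?b) (a + (?a + ?b - a))"
        using lm_le[OF nz(2)] by (rule add_left_mono)
      then have "le (a + ?b) (?a + ?b)" using sum by simp
      moreover have "le (?a + ?b) (a + ?b)"
        using add_mono[OF lm_le[OF nz(1)] order_refl] .
      ultimately show ?thesis using order_antisym by force
    qed
    then show "mfps_coeff q a * mfps_coeff s (?a + ?b - a) =
        (if a = ?a then lc le q * lc le s else 0)"
      by (cases "mfps_coeff q a = 0 \<or> mfps_coeff s (?a + ?b - a) = 0") (auto simp: lc_def)
  qed
  also have "\<dots> = lc le q * lc le s"
    by (simp add: sum.delta finite_submultisets)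
  finally show ?thesis .
qed


section \<open>Division with remainder\<close>

text \<open>
  Sweep through the monomials in increasing order, and let the step of rank \<open>k\<close> remove the
  monomial \<open>nth_monomial k\<close> whenever a leading monomial of \<open>G\<close> divides it.  A step leaves all
  smaller coefficients alone, so each coefficient of the dividend is settled after finitely
  many steps, and the sequence converges.  The multipliers that the steps use are collected, for
  each \<open>s \<in> G\<close>, in one series \<open>q s\<close>; hence the limit differs from the dividend by an element of
  the ideal itself, not just of its closure.
\<close>

lemma division:
  fixes f :: "('v, 'a::field) mfps"
  assumes "finite G" "0 \<notin> G"
  obtains r where "chain_rewrite le G f r" "f - r \<in> ideal_generated G"
    "\<forall>m\<in>mfps_supp r. \<forall>s\<in>G. \<not> lm le s \<subseteq># m"
proof -
  define red where "red m \<longleftrightarrow> (\<exists>s\<in>G. lm le s \<subseteq># m)" for m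
  define \<sigma> where "\<sigma> m = (SOME s. s \<in> G \<and> lm le s \<subseteq># m)" for m
  have \<sigma>: "\<sigma> m \<in> G" "lm le (\<sigma> m) \<subseteq># m" if "red m" for m
    using someI_ex[of "\<lambda>s. s \<in> G \<and> lm le s \<subseteq># m"] that unfolding red_def \<sigma>_def by blast+
  define mult where "mult h m =
    mfps_term (mfps_coeff h m / lc le (\<sigma> m)) (m - lm le (\<sigma> m))" for h m
  define step where "step h m = (if red m then h - mult h m * \<sigma> m else h)" for h m
  define h where "h = rec_nat f (\<lambda>k h. step h (nth_monomial k))"
  have h_0: "h 0 = f" and h_Suc: "h (Suc k) = step (h k) (nth_monomial k)" for k
    by (simp_all add: h_def)

  have G_nonzero: "\<And>s. s \<in> G \<Longrightarrow> s \<noteq> 0"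
    using assms(2) by blast
  \<comment> \<open>The subtracted multiple of \<open>\<sigma> m\<close> starts at \<open>m\<close>, so smaller monomials are untouched.\<close>
  have step_above: "le m b"
    if "red m" "mfps_coeff (mult p m * \<sigma> m) b \<noteq> 0" for p m b
  proof -
    from that(2) have sub: "m - lm le (\<sigma> m) \<subseteq># b"
      and nz: "mfps_coeff (\<sigma> m) (b - (m - lm le (\<sigma> m))) \<noteq> 0"
      unfolding mult_def by (auto simp: mfps_coeff_term_mult split: if_splits)
    have "le (m - lm le (\<sigma> m) + lm le (\<sigma> m)) (m - lm le (\<sigma> m) + (b - (m - lm le (\<sigma> m))))"
      by (intro add_left_mono lm_le nz)
    then show ?thesis using sub \<sigma>(2)[OF that(1)] by simp
  qed
  have step_kill: "mfps_coeff (step p m) m = 0" if "red m" for p m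
  proof -
    have "m - (m - lm le (\<sigma> m)) = lm le (\<sigma> m)"
      using \<sigma>(2)[OF that] by (simp add: subset_mset.diff_diff_right)
    then show ?thesis
      using that lc_nonzero[OF G_nonzero[OF \<sigma>(1)[OF that]]]
      by (simp add: step_def mult_def mfps_coeff_term_mult lc_def)
  qed
  have step_rewrite: "(rewrite_step le G)\<^sup>=\<^sup>= p (step p m)" for p m
  proof (cases "red m \<and> mfps_coeff p m \<noteq> 0")
    case True
    then have "m = (m - lm le (\<sigma> m)) + lm le (\<sigma> m)"
      using \<sigma>(2) by simp
    with True have "rewrite_step le G p (step p m)"
      unfolding rewrite_step_def
      by (intro bexI[of _ m] bexI[of _ "\<sigma> m"] exI[of _ "m - lm le (\<sigma> m)"] conjI)
        (simp_all add: step_def mult_def mfps_supp_def \<sigma>(1))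
    then show ?thesis by blast
  next
    case False
    then have "step p m = p"
      by (auto simp: step_def mult_def mfps_coeff_term_mult intro!: mfps_eqI)
    then show ?thesis by simp
  qed

  have settled_Suc: "mfps_coeff (h (Suc k)) m = mfps_coeff (h k) m" if "rank m < k" for k m
    using step_above[of "nth_monomial k" "h k" m] that
    by (auto simp: h_Suc step_def simp flip: rank_le_iff)
  have settled: "mfps_coeff (h (Suc (rank m) + j)) m = mfps_coeff (h (Suc (rank m))) m" for m j
    by (induction j) (simp_all add: settled_Suc)
  define r where "r = Abs_mfps (\<lambda>m. mfps_coeff (h (Suc (rank m))) m)"
  have h_eq_r: "mfps_coeff (h k) m = mfps_coeff r m" if "rank m < k" for k m
    using settled[of m "k - Suc (rank m)"] that by (simp add: r_def)
  have "h \<longlonglongrightarrow> r"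
    by (rule mfps_tendstoI) (rule eventually_mono[OF eventually_gt_at_top h_eq_r])
  then have chain: "chain_rewrite le G f r"
    unfolding chain_rewrite_def using h_0 h_Suc step_rewrite by (intro exI[of _ h]) simp

  define q where "q s = Abs_mfps (\<lambda>m. let b = m + lm le s in
      if \<sigma> b = s then mfps_coeff (h (rank b)) b / lc le s else 0)" for s
  define q_upto where "q_upto k s = Abs_mfps (\<lambda>m.
      if rank (m + lm le s) < k then mfps_coeff (q s) m else 0)" for k s
  have partial: "f - h k = (\<Sum>s\<in>G. q_upto k s * s)" for k
  proof (induction k)
    case 0
    have "q_upto 0 s = 0" for s
      by (rule mfps_eqI) (simp add: q_upto_def)
    then show ?case by (simp add: h_0)
  next
    case (Suc k)
    let ?b = "nth_monomial k"
    \<comment> \<open>Only the divisor chosen for the monomial of rank \<open>k\<close> receives a new multiplier.\<close>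
    have increment: "q_upto (Suc k) s =
        q_upto k s + (if red ?b \<and> \<sigma> ?b = s then mult (h k) ?b else 0)" if "s \<in> G" for s
    proof (rule mfps_eqI)
      fix m
      show "mfps_coeff (q_upto (Suc k) s) m = mfps_coeff
          (q_upto k s + (if red ?b \<and> \<sigma> ?b = s then mult (h k) ?b else 0)) m"
      proof (cases "m + lm le s = ?b")
        case True
        then have "rank (m + lm le s) = k" by simp
        moreover have "red ?b"
          using that True unfolding red_def by (metis mset_subset_eq_add_right)
        moreover have "?b - lm le s = m" using True by (metis add_diff_cancel_right')
        ultimately show ?thesis
          using True by (auto simp: q_upto_def q_def mult_def mfps_term_def Let_def)
      next
        case False
        then have "rank (m + lm le s) \<noteq> k"
          by (metis nth_monomial_rank)
        moreover have "mfps_coeff (mult (h k) ?b) m = 0" if "red ?b" "\<sigma> ?b = s"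
          using that False \<sigma>(2)[OF that(1)] by (auto simp: mult_def mfps_term_def)
        ultimately show ?thesis
          by (auto simp: q_upto_def less_Suc_eq)
      qed
    qed
    have "(\<Sum>s\<in>G. q_upto (Suc k) s * s) =
        (\<Sum>s\<in>G. q_upto k s * s + (if \<sigma> ?b = s then if red ?b then mult (h k) ?b * s else 0 else 0))"
      by (rule sum.cong) (auto simp: increment distrib_right)
    also have "\<dots> = f - h k + (if red ?b then mult (h k) ?b * \<sigma> ?b else 0)"
      using assms(1) \<sigma>(1)[of ?b] by (auto simp: sum.distrib Suc.IH sum.delta')
    also have "\<dots> = f - h (Suc k)"
      by (simp add: h_Suc step_def)
    finally show ?case by simp
  qed
  \<comment> \<open>Multipliers of rank beyond \<open>rank m\<close> only affect coefficients beyond \<open>m\<close>.\<close>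
  have q_upto_mult: "mfps_coeff (q_upto (Suc (rank m)) s * s) m = mfps_coeff (q s * s) m" for m s
    unfolding mfps_coeff_mult
  proof (rule sum.cong[OF refl])
    fix a assume "a \<in> {a. a \<subseteq># m}"
    then have a: "a + (m - a) = m" by simp
    have "rank (a + lm le s) \<le> rank m" if "mfps_coeff s (m - a) \<noteq> 0"
      using add_left_mono[OF lm_le[OF that], of a] unfolding rank_le_iff a .
    then show "mfps_coeff (q_upto (Suc (rank m)) s) a * mfps_coeff s (m - a) =
        mfps_coeff (q s) a * mfps_coeff s (m - a)"
      by (cases "mfps_coeff s (m - a) = 0") (auto simp: q_upto_def)
  qed
  have "f - r = (\<Sum>s\<in>G. q s * s)"
  proof (rule mfps_eqI)
    fix m
    have "mfps_coeff (f - r) m = mfps_coeff (f - h (Suc (rank m))) m"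
      using h_eq_r[of m "Suc (rank m)"] by simp
    also have "\<dots> = mfps_coeff (\<Sum>s\<in>G. q s * s) m"
      unfolding partial mfps_coeff_sum q_upto_mult ..
    finally show "mfps_coeff (f - r) m = mfps_coeff (\<Sum>s\<in>G. q s * s) m" .
  qed
  also have "\<dots> \<in> ideal_generated G"
    using assms(1) unfolding ideal_generated_def
    by (intro module.span_sum[OF module_self] ideal_generated_mult[unfolded ideal_generated_def])
  finally have ideal: "f - r \<in> ideal_generated G" .

  have "\<forall>m\<in>mfps_supp r. \<forall>s\<in>G. \<not> lm le s \<subseteq># m"
  proof (intro ballI)
    fix m s assume "m \<in> mfps_supp r" "s \<in> G"
    then show "\<not> lm le s \<subseteq># m"
      using step_kill[of m "h (rank m)"] by (auto simp: r_def mfps_supp_def h_Suc red_def)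
  qed
  with chain ideal show thesis by (rule that)
qed


section \<open>Ideals are closed\<close>

lemma finite_standard_basis:
  obtains G :: "('v, 'a::field) mfps set"
  where "finite G" "0 \<notin> G" "G \<subseteq> I" "\<forall>f\<in>I. f \<noteq> 0 \<longrightarrow> (\<exists>g\<in>G. lm le g \<subseteq># lm le f)"
proof -
  obtain B where B: "B \<subseteq> lm le ` (I - {0})" "finite B"
    "\<forall>a\<in>lm le ` (I - {0}). \<exists>b\<in>B. b \<subseteq># a"
    by (rule dickson)
  obtain G where G: "G \<subseteq> I - {0}" "finite G" "B = lm le ` G"
    using finite_subset_image[OF B(2,1)] by blast
  show thesis
    by (rule that[of G]) (use G B(3) in auto)
qed

text \<open>
  Divide an element of the closure by a finite standard basis.  If the remainder \<open>r\<close> were non-zero,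
  it would be approximated by elements of the ideal up to the degree of \<open>lm r\<close>.  As the order is
  compatible with the degree, such an approximation has the leading monomial of \<open>r\<close>, which
  the standard basis would then be able to reduce.
\<close>

lemma closed_ideal_generated:
  fixes R :: "('v, 'a::field) mfps set"
  shows "closed (ideal_generated R)"
proof -
  have "u \<in> ideal_generated R" if u: "u \<in> closure (ideal_generated R)" for u
  proof -
    obtain G where G: "finite G" "0 \<notin> G" "G \<subseteq> ideal_generated R"
      "\<forall>f\<in>ideal_generated R. f \<noteq> 0 \<longrightarrow> (\<exists>g\<in>G. lm le g \<subseteq># lm le f)"
      by (rule finite_standard_basis)
    obtain r where "chain_rewrite le G u r" and r: "u - r \<in> ideal_generated G"
      "\<forall>m\<in>mfps_supp r. \<forall>s\<in>G. \<not> lm le s \<subseteq># m"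
      by (rule division[OF G(1,2)])
    have ur: "u - r \<in> ideal_generated R"
      using r(1) ideal_generated_subset[OF G(3)] by blast
    have "r = 0"
    proof (rule ccontr)
      assume "r \<noteq> 0"
      then have lm_supp: "lm le r \<in> mfps_supp r"
        using lm_least_in_supp by blast
      obtain i where i: "i \<in> ideal_generated R"
        "\<And>m. size m \<le> size (lm le r) \<Longrightarrow> mfps_coeff i m = mfps_coeff u m"
        using u unfolding closure_mfps_iff by blast
      define j where "j = i - (u - r)"
      have j: "j \<in> ideal_generated R"
        unfolding j_def using i(1) ur by (rule ideal_generated_diff)
      have j_eq: "mfps_coeff j m = mfps_coeff r m" if "size m \<le> size (lm le r)" for m
        using i(2)[OF that] by (simp add: j_def)
      have lm_j: "mfps_coeff j (lm le r) \<noteq> 0"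
        using lm_supp by (simp add: j_eq mfps_supp_def)
      have "lm le j = lm le r"
      proof (rule lm_eqI[OF lm_j])
        fix m assume "mfps_coeff j m \<noteq> 0"
        then show "le (lm le r) m"
          using j_eq[of m] lm_le[of r m] linear[of m "lm le r"] size_mono[of m "lm le r"]
          by (cases "le m (lm le r)") auto
      qed
      moreover have "j \<noteq> 0" using lm_j by auto
      ultimately show False
        using G(4) j r(2) lm_supp by auto
    qed
    with ur show ?thesis by simp
  qed
  then have "closure (ideal_generated R) = ideal_generated R"
    using closure_subset by blast
  then show ?thesis by (simp add: closure_eq)
qed

lemma top_rewrite_ideal_cong:
  fixes R :: "('v, 'a::field) mfps set"
  assumes "top_rewrite le R f g"
  shows "ideal_cong (ideal_generated R) f g"
proof -
  have "closed {g. ideal_cong (ideal_generated R) f g}"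
    using continuous_closed_vimage[OF closed_ideal_generated[of R], of "\<lambda>g. f - g"]
      continuous_on_mfps_diff[of f]
    by (simp add: ideal_cong_def vimage_def continuous_on_eq_continuous_at)
  then have "closure {g. (rewrite_step le R)\<^sup>*\<^sup>* f g} \<subseteq> {g. ideal_cong (ideal_generated R) f g}"
    by (intro closure_minimal) (auto intro: rewrite_steps_ideal_cong)
  with assms show ?thesis
    unfolding top_rewrite_iff by blast
qed


section \<open>Congruent series are connected by chains\<close>

text \<open>
  A single series \<open>s\<close> is a standard basis of the ideal it generates, because
  \<open>lm (q * s) = lm q + lm s\<close>; so the remainders of \<open>f\<close> and \<open>g\<close> modulo \<open>s\<close> coincide, and both
  \<open>f\<close> and \<open>g\<close> rewrite to it.
\<close>

lemma principal_common_remainder: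
  fixes s :: "('v, 'a::field) mfps"
  assumes "s \<noteq> 0" "f - g = c * s"
  obtains r where "chain_rewrite le {s} f r" "chain_rewrite le {s} g r"
proof -
  have "finite {s}" "0 \<notin> {s}" using assms(1) by auto
  note div = division[OF this]
  obtain r where r: "chain_rewrite le {s} f r" "f - r \<in> ideal_generated {s}"
    "\<forall>m\<in>mfps_supp r. \<forall>s'\<in>{s}. \<not> lm le s' \<subseteq># m"
    by (rule div)
  obtain r' where r': "chain_rewrite le {s} g r'" "g - r' \<in> ideal_generated {s}"
    "\<forall>m\<in>mfps_supp r'. \<forall>s'\<in>{s}. \<not> lm le s' \<subseteq># m"
    by (rule div)
  have "f - g \<in> ideal_generated {s}"
    unfolding assms(2) by (simp add: ideal_generated_mult)
  then have "(f - g) + (g - r') - (f - r) \<in> ideal_generated {s}"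
    by (rule ideal_generated_diff[OF ideal_generated_add[OF _ r'(2)] r(2)])
  then have "r - r' \<in> ideal_generated {s}" by simp
  then obtain q where q: "r - r' = q * s"
    unfolding ideal_generated_def module.span_singleton[OF module_self] by blast
  have "r = r'"
  proof (rule ccontr)
    assume "r \<noteq> r'"
    then have "q \<noteq> 0" using q by auto
    let ?m = "lm le q + lm le s"
    have "mfps_coeff (r - r') ?m \<noteq> 0"
      unfolding q mfps_coeff_mult_lm using \<open>q \<noteq> 0\<close> assms(1) by (simp add: lc_nonzero)
    then have "?m \<in> mfps_supp r \<or> ?m \<in> mfps_supp r'"
      by (auto simp: mfps_supp_def)
    then show False
      using r(3) r'(3) mset_subset_eq_add_right[of "lm le s" "lm le q"] by blast
  qed
  with r(1) r'(1) show thesis by (auto intro: that)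
qed

text \<open>
  The induction follows how \<open>f - g\<close> is built up from multiples of generators: a summand
  \<open>c * s\<close> is crossed by passing from \<open>f\<close> to \<open>f - c * s\<close> through their common remainder.
\<close>

lemma ideal_cong_imp_chain_equiv:
  fixes R :: "('v, 'a::field) mfps set"
  assumes "0 \<notin> R" "ideal_cong (ideal_generated R) f g"
  shows "equivclp (chain_rewrite le R) f g"
proof -
  have "f - g \<in> module.span (*) R"
    using assms(2) by (simp add: ideal_cong_def ideal_generated_def)
  then have "\<forall>f' g'. f' - g' = f - g \<longrightarrow> equivclp (chain_rewrite le R) f' g'"
  proof (rule module.span_induct_alt[OF module_self,
      of _ R "\<lambda>x. \<forall>f' g'. f' - g' = x \<longrightarrow> equivclp (chain_rewrite le R) f' g'"])
    show "\<forall>f' g'. f' - g' = 0 \<longrightarrow> equivclp (chain_rewrite le R) f' g'"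
      by simp
  next
    fix c s y
    assume s: "s \<in> R"
      and IH: "\<forall>f' g'. f' - g' = y \<longrightarrow> equivclp (chain_rewrite le R) f' g'"
    show "\<forall>f' g'. f' - g' = c * s + y \<longrightarrow> equivclp (chain_rewrite le R) f' g'"
    proof (intro allI impI)
      fix f' g' assume diff: "f' - g' = c * s + y"
      have "s \<noteq> 0" using s assms(1) by blast
      moreover have "f' - (f' - c * s) = c * s" by simp
      ultimately obtain r
        where "chain_rewrite le {s} f' r" "chain_rewrite le {s} (f' - c * s) r"
        by (rule principal_common_remainder)
      then have "chain_rewrite le R f' r" "chain_rewrite le R (f' - c * s) r"
        using s by (auto elim: chain_rewrite_mono[rotated])
      then have "equivclp (chain_rewrite le R) f' (f' - c * s)"
        by (meson equivclp_sym equivclp_trans r_into_equivclp)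
      moreover have "(f' - c * s) - g' = y"
        using diff by (simp add: algebra_simps)
      with IH have "equivclp (chain_rewrite le R) (f' - c * s) g'"
        by blast
      ultimately show "equivclp (chain_rewrite le R) f' g'"
        by (rule equivclp_trans)
    qed
  qed
  then show ?thesis by blast
qed

end

lemma equivclp_least:
  assumes "equivp E" "\<And>x y. r x y \<Longrightarrow> E x y" "equivclp r x y"
  shows "E x y"
  using assms(3)
  by induction (use assms(1,2) in \<open>blast intro: equivp_reflp equivp_symp equivp_transp\<close>)+

theorem theorem24:
  fixes le :: "'v::finite multiset \<Rightarrow> 'v multiset \<Rightarrow> bool"
    and R :: "('v, 'a::field) mfps set"
  assumes "monomial_order le"
    and "admissible le"
    and "degree_compatible le"
    and "finite R"
    and "0 \<notin> R"
  shows "ideal_cong (ideal_generated R) = equivclp (top_rewrite le R) \<and>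
    equivclp (top_rewrite le R) = equivclp (chain_rewrite le R)"
proof -
  interpret graded_monomial_order le
    using assms(1,3) by unfold_locales
  have "ideal_cong (ideal_generated R) \<le> equivclp (chain_rewrite le R)"
    using ideal_cong_imp_chain_equiv[OF assms(5)] by blast
  moreover have "equivclp (chain_rewrite le R) \<le> equivclp (top_rewrite le R)"
    by (intro predicate2I, erule equivclp_least[OF equivp_evquivclp, rotated])
      (intro r_into_equivclp chain_rewrite_imp_top_rewrite)
  moreover have "equivclp (top_rewrite le R) \<le> ideal_cong (ideal_generated R)"
    by (intro predicate2I, erule equivclp_least[OF ideal_cong_equivp, rotated])
      (rule top_rewrite_ideal_cong)
  ultimately show ?thesis by (meson order_class.order_antisym preorder_class.order_trans)
qed

end
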